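(* Let $X$ be an infinite compact Hausdorff topological space that is scattered, i.e. every non-empty closed subspace of $X$ has an isolated point. Then $X$ contains a non-trivial convergent sequence: there exist a sequence $(a_n)_{n<\omega}$ of points of $X$ that is not eventually constant and a point $a\in X$ such that $a_n\to a$.
   Context: A point $y$ of a (sub)space $Y$ is isolated in $Y$ if $\{y\}$ is open in $Y$ (with the subspace topology). A sequence $(a_n)$ converges to $a$ if every open neighbourhood of $a$ contains all but finitely many terms of the sequence. A sequence is trivial if it is eventually constant, and non-trivial otherwise. *)

theory Defs
  imports "HOL-Analysis.Analysis"
begin

(* openin already forces y to be a point of Y. *)
definition isolated_point :: "'a topology \<Rightarrow> 'a \<Rightarrow> bool" where
  "isolated_point Y y \<longleftrightarrow> openin Y {y}"

definition scattered_space :: "'a topology \<Rightarrow> bool" where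
  "scattered_space X \<longleftrightarrow>
     (\<forall>C. closedin X C \<and> C \<noteq> {} \<longrightarrow> (\<exists>y. isolated_point (subtopology X C) y))"

definition eventually_constant :: "(nat \<Rightarrow> 'a) \<Rightarrow> bool" where
  "eventually_constant a \<longleftrightarrow> (\<exists>c. eventually (\<lambda>n. a n = c) sequentially)"

end

theory Submission
  imports Defs
begin

text \<open>Let \<open>D\<close> be the closed set of non-isolated points; it is non-empty since a compact discrete
  space is finite. Pick a point \<open>l\<close> isolated in \<open>D\<close> and, by regularity, a closed neighbourhood \<open>C\<close>
  of \<open>l\<close> meeting \<open>D\<close> only in \<open>l\<close>. Then \<open>C - {l}\<close> is infinite and, for every open \<open>W\<close> containing
  \<open>l\<close>, the compact set \<open>C - W\<close> consists of isolated points and so is finite. Hence every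
  injective sequence in \<open>C - {l}\<close> converges to \<open>l\<close>.\<close>

text \<open>The singletons of points of \<open>K\<close> form an open cover, and a finite subcover
  has finite union.\<close>

lemma compactin_isolated_points_imp_finite:
  assumes "compactin X K" and "\<And>x. x \<in> K \<Longrightarrow> isolated_point X x"
  shows "finite K"
proof -
  have "\<forall>U\<in>(\<lambda>x. {x}) ` K. openin X U" "K \<subseteq> \<Union>((\<lambda>x. {x}) ` K)"
    using assms(2) by (auto simp: isolated_point_def)
  then obtain F where F: "finite F" "F \<subseteq> (\<lambda>x. {x}) ` K" "K \<subseteq> \<Union>F"
    using assms(1) unfolding compactin_def by metis
  then have "finite (\<Union>F)"
    by auto
  then show ?thesis
    using F(3) by (rule finite_subset[rotated])
qed

text \<open>The finite set \<open>V - {x}\<close> is closed by T1, so removing it from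
  \<open>V\<close> leaves an open set.\<close>

lemma finite_open_imp_isolated_point:
  assumes "t1_space X" "openin X V" "finite V" "x \<in> V"
  shows "isolated_point X x"
proof -
  have "V - {x} \<subseteq> topspace X"
    using assms(2) openin_subset by blast
  then have "closedin X (V - {x})"
    using assms(1,3) by (simp add: t1_space_closedin_finite)
  then have "openin X (V - (V - {x}))"
    using assms(2) by blast
  moreover have "V - (V - {x}) = {x}"
    using assms(4) by blast
  ultimately show ?thesis
    by (simp add: isolated_point_def)
qed

lemma closedin_nonisolated_points:
  "closedin X {x \<in> topspace X. \<not> isolated_point X x}"
proof -
  have "openin X (\<Union>{{x} |x. openin X {x}})"
    by (rule openin_Union) auto
  moreover have "topspace X - {x \<in> topspace X. \<not> isolated_point X x} = \<Union>{{x} |x. openin X {x}}"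
    by (auto simp: isolated_point_def dest: openin_subset)
  ultimately show ?thesis
    by (auto simp: closedin_def)
qed

text \<open>By injectivity only finitely many indices are sent into the finite set
  \<open>C - W\<close>.\<close>

lemma inj_sequence_limitin:
  fixes a :: "nat \<Rightarrow> 'a"
  assumes "inj a" "range a \<subseteq> C" "l \<in> topspace X"
    and "\<And>W. openin X W \<Longrightarrow> l \<in> W \<Longrightarrow> finite (C - W)"
  shows "limitin X a l sequentially"
  unfolding limitin_def
proof (intro conjI allI impI)
  fix W
  assume "openin X W \<and> l \<in> W"
  then have "finite (a -` (C - W))"
    using assms(1,4) by (simp add: finite_vimageI)
  then have "\<forall>\<^sub>F n in sequentially. n \<notin> a -` (C - W)"
    by (simp add: cofinite_eq_sequentially[symmetric] eventually_cofinite vimage_def)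
  then show "\<forall>\<^sub>F n in sequentially. a n \<in> W"
    by (rule eventually_mono) (use assms(2) in auto)
qed (use assms(3) in auto)

lemma inj_not_eventually_constant:
  assumes "inj a"
  shows "\<not> eventually_constant a"
proof
  assume "eventually_constant a"
  then obtain c N where "\<forall>n\<ge>N. a n = c"
    by (auto simp: eventually_constant_def eventually_sequentially)
  then have "a N = a (Suc N)"
    by simp
  then show False
    using assms by (simp add: inj_eq)
qed

theorem theorem2p1p2:
  fixes X :: "'a topology"
  assumes "infinite (topspace X)"
    and "compact_space X"
    and "Hausdorff_space X"
    and "scattered_space X"
  shows "\<exists>(a :: nat \<Rightarrow> 'a) l.
           (\<forall>n. a n \<in> topspace X) \<and> \<not> eventually_constant a \<and> l \<in> topspace X \<and>
           limitin X a l sequentially"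
proof -
  define D where "D = {x \<in> topspace X. \<not> isolated_point X x}"
  have "D \<noteq> {}"
    using assms(1,2) compactin_isolated_points_imp_finite[of X "topspace X"]
    by (auto simp: D_def compact_space_def)
  moreover have "closedin X D"
    unfolding D_def by (rule closedin_nonisolated_points)
  ultimately obtain l where "openin (subtopology X D) {l}"
    using assms(4) by (auto simp: scattered_space_def isolated_point_def)
  then obtain U where U: "openin X U" "{l} = U \<inter> D"
    by (auto simp: openin_subtopology)
  then have l: "l \<in> topspace X" "l \<in> U" "\<not> isolated_point X l"
    by (auto simp: D_def)
  have "regular_space X"
    using assms(2,3) by (simp add: compact_Hausdorff_imp_regular_space)
  moreover have "closedin X (topspace X - U)"
    using U(1) by blast
  ultimately obtain V V' where V: "openin X V" "openin X V'" "l \<in> V" "topspace X - U \<subseteq> V'"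
      "disjnt V V'"
    unfolding regular_space_def using l by (metis DiffI DiffD2)
  \<comment> \<open>As \<open>V'\<close> covers the complement of \<open>U\<close>, the closed set
    \<open>C\<close> lies inside \<open>U\<close> and so meets \<open>D\<close> at most in
    \<open>l\<close>; disjointness from \<open>V'\<close> puts \<open>V\<close> inside
    \<open>C\<close>.\<close>
  define C where "C = topspace X - V'"
  have C: "closedin X C" "V \<subseteq> C" "C \<subseteq> topspace X"
    using V openin_subset[OF V(1)] by (auto simp: C_def disjnt_def)
  have isol: "isolated_point X x" if "x \<in> C - {l}" for x
    using that U(2) V(4) by (auto simp: C_def D_def)
  have fin: "finite (C - W)" if "openin X W" "l \<in> W" for W
  proof (rule compactin_isolated_points_imp_finite)
    show "compactin X (C - W)"
      using C(1) that(1) assms(2) by (simp add: closedin_compact_space closedin_diff)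
  qed (use isol that in auto)
  \<comment> \<open>A finite open \<open>V\<close> would make \<open>l\<close> isolated in
    \<open>X\<close>, but \<open>l\<close> lies in \<open>D\<close>.\<close>
  have "infinite V"
    using finite_open_imp_isolated_point[of X V l] V l(3) Hausdorff_imp_t1_space[OF assms(3)]
    by blast
  then have "infinite C"
    using C(2) finite_subset by blast
  \<comment> \<open>The sequence may take the value \<open>l\<close>, at most once; this is
    harmless, since \<open>l\<close> lies in every \<open>W\<close> under consideration.\<close>
  then obtain a :: "nat \<Rightarrow> 'a" where a: "inj a" "range a \<subseteq> C"
    using infinite_countable_subset by blast
  then have "limitin X a l sequentially"
    using l(1) fin by (rule inj_sequence_limitin)
  then show ?thesis
    using a C(3) l(1) inj_not_eventually_constant[OF a(1)] by blast
qed

end
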